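(* Assume $d_{i}\geq2$ for $i=1,\ldots,l$. If $T\in GL_{\otimes}\left(\otimes_{i=1}^{l}\mathbb{R}^{d_{i}}\right)$ and $Q\in\mathcal{B}_{\otimes}\left(\otimes_{i=1}^{l}\mathbb{R}^{d_{i}}\right)$, then $TQ\in\mathcal{B}_{\otimes}\left(\otimes_{i=1}^{l}\mathbb{R}^{d_{i}}\right)$.
   Context: Here $l$ and $d_1,\dots,d_l$ are positive integers. $\langle\cdot,\cdot\rangle$ is the standard scalar product on $\mathbb{R}^{d}$, and $\langle\cdot,\cdot\rangle_H$ is the scalar product on $\otimes_{i=1}^l\mathbb{R}^{d_i}$ determined by $\langle x^1\otimes\cdots\otimes x^l,y^1\otimes\cdots\otimes y^l\rangle_H=\prod_{i=1}^l\langle x^i,y^i\rangle$. In a Euclidean space $\mathbb{E}$, a convex body is a compact convex set with nonempty interior; it is $0$-symmetric if $P=-P$. The polar set of a nonempty $C\subset\mathbb{E}$ is $C^\circ=\{y\in\mathbb{E}:\sup_{x\in C}|\langle x,y\rangle_{\mathbb{E}}|\le 1\}$ (with $\langle\cdot,\cdot\rangle$ in $\mathbb{R}^{d_i}$ and $\langle\cdot,\cdot\rangle_H$ in the tensor product). For $0$-symmetric convex bodies $Q_i\subset\mathbb{R}^{d_i}$: $Q_1\otimes_\pi\cdots\otimes_\pi Q_l:=\mathrm{conv}\{x^1\otimes\cdots\otimes x^l:x^i\in Q_i,\ i=1,\dots,l\}$ and $Q_1\otimes_\epsilon\cdots\otimes_\epsilon Q_l:=(Q_1^\circ\otimes_\pi\cdots\otimes_\pi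 Q_l^\circ)^\circ$. $\mathcal{B}_\otimes(\otimes_{i=1}^l\mathbb{R}^{d_i})$ is the set of tensorial bodies in $\otimes_{i=1}^l\mathbb{R}^{d_i}$, i.e. the $0$-symmetric convex bodies $Q\subset\otimes_{i=1}^l\mathbb{R}^{d_i}$ for which there exist $0$-symmetric convex bodies $Q_i\subset\mathbb{R}^{d_i}$ with $Q_{1}\otimes_{\pi}\cdots\otimes_{\pi}Q_{l}\subseteq Q\subseteq Q_{1}\otimes_{\epsilon}\cdots\otimes_{\epsilon}Q_{l}$. $GL_\otimes(\otimes_{i=1}^l\mathbb{R}^{d_i})$ is the set of linear isomorphisms $T:\otimes_{i=1}^l\mathbb{R}^{d_i}\to\otimes_{i=1}^l\mathbb{R}^{d_i}$ that preserve decomposable vectors, i.e. $T(x^1\otimes\cdots\otimes x^l)$ is a decomposable vector (of the form $y^1\otimes\cdots\otimes y^l$) for all $x^i\in\mathbb{R}^{d_i}$. *)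

theory Defs
  imports "HOL-Analysis.Analysis"
begin

text \<open>
  The factors are indexed by a finite type \<open>'l\<close>, so that \<open>l = CARD('l)\<close>. Since the dimensions
  \<open>d\<^sub>i\<close> may differ from factor to factor, the space \<open>\<real>\<^bsup>d\<^sub>i\<^esup>\<close> is the coordinate subspace of
  \<open>real ^ 'n\<close> of the vectors supported on an index set \<open>D i\<close> with \<open>card (D i) = d\<^sub>i\<close>. The type
  \<open>'n\<close> is arbitrary, so every tuple of dimensions occurs. Tensors are arrays indexed by
  multi-indices \<open>m :: 'l \<Rightarrow> 'n\<close>, supported on the \<open>m\<close> with \<open>m i \<in> D i\<close> for all \<open>i\<close>.
\<close>

definition coord_space :: "'n set \<Rightarrow> (real ^ 'n::finite) set" where
  "coord_space S = {x. \<forall>j. j \<notin> S \<longrightarrow> x $ j = 0}"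

definition tensor_space :: "('l::finite \<Rightarrow> 'n::finite set) \<Rightarrow> (real ^ ('l \<Rightarrow> 'n)) set" where
  "tensor_space D = {t. \<forall>m. (\<exists>i. m i \<notin> D i) \<longrightarrow> t $ m = 0}"

definition tensor :: "('l::finite \<Rightarrow> real ^ 'n::finite) \<Rightarrow> real ^ ('l \<Rightarrow> 'n)" where
  "tensor x = (\<chi> m. \<Prod>i\<in>UNIV. x i $ m i)"

definition decomposable :: "('l::finite \<Rightarrow> 'n::finite set) \<Rightarrow> real ^ ('l \<Rightarrow> 'n) \<Rightarrow> bool" where
  "decomposable D t \<longleftrightarrow> (\<exists>x. (\<forall>i. x i \<in> coord_space (D i)) \<and> t = tensor x)"

lemma subspace_coord_space: "subspace (coord_space S)"
  by (auto simp: subspace_def coord_space_def)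

lemma dim_coord_space: "dim (coord_space S) = card S"
  using dim_substandard_cart [where 'a = real and d = S]
  unfolding dim_vec_eq coord_space_def by simp

lemma subspace_tensor_space: "subspace (tensor_space D)"
  by (auto simp: subspace_def tensor_space_def)

text \<open>The next two facts identify \<open>tensor_space D\<close>, with the standard inner product on arrays, as
  the tensor product of the coordinate spaces with the scalar product \<open>\<langle>\<cdot>,\<cdot>\<rangle>\<^sub>H\<close>.\<close>

lemma inner_tensor: "tensor x \<bullet> tensor y = (\<Prod>i\<in>UNIV. x i \<bullet> y i)"
proof -
  have "(\<Prod>i\<in>UNIV. x i \<bullet> y i) = (\<Prod>i\<in>UNIV. \<Sum>j\<in>UNIV. x i $ j * y i $ j)"
    by (simp add: inner_vec_def)
  also have "\<dots> = (\<Sum>m\<in>PiE UNIV (\<lambda>_. UNIV). \<Prod>i\<in>UNIV. x i $ m i * y i $ m i)"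
    by (rule prod_sum_PiE) auto
  also have "\<dots> = tensor x \<bullet> tensor y"
    by (simp add: inner_vec_def tensor_def prod.distrib PiE_UNIV_domain)
  finally show ?thesis by simp
qed

lemma span_decomposable: "span (Collect (decomposable D)) = tensor_space D"
proof
  show "span (Collect (decomposable D)) \<subseteq> tensor_space D"
  proof (rule span_minimal)
    show "Collect (decomposable D) \<subseteq> tensor_space D"
    proof
      fix t assume "t \<in> Collect (decomposable D)"
      then obtain x where x: "\<forall>i. x i \<in> coord_space (D i)" "t = tensor x"
        unfolding decomposable_def by blast
      have "t $ m = 0" if "m i \<notin> D i" for m i
        unfolding x(2) tensor_def using x(1) that
        by (simp add: coord_space_def) (metis)
      then show "t \<in> tensor_space D" unfolding tensor_space_def by blast
    qed
  qed (rule subspace_tensor_space)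
  have ax: "axis m (1::real) \<in> Collect (decomposable D)" if "\<forall>i. m i \<in> D i" for m
  proof -
    have "axis m (1::real) = tensor (\<lambda>i. axis (m i) 1)"
    proof (rule vec_eq_iff [THEN iffD2], rule allI)
      fix k
      show "axis m (1::real) $ k = tensor (\<lambda>i. axis (m i) 1) $ k"
      proof (cases "k = m")
        case True
        then show ?thesis by (simp add: tensor_def)
      next
        case False
        then obtain i where "k i \<noteq> m i" by blast
        then have "(\<Prod>i\<in>UNIV. axis (m i) (1::real) $ k i) = 0"
          by (intro prod_zero) (auto simp: axis_def)
        with False show ?thesis by (simp add: tensor_def axis_def)
      qed
    qed
    moreover have "\<forall>i. axis (m i) (1::real) \<in> coord_space (D i)"
      using that by (auto simp: coord_space_def axis_def)
    ultimately show ?thesis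
      unfolding decomposable_def mem_Collect_eq
      by (intro exI [of _ "\<lambda>i. axis (m i) 1"]) simp
  qed
  show "tensor_space D \<subseteq> span (Collect (decomposable D))"
  proof
    fix t assume t: "t \<in> tensor_space D"
    have "t = (\<Sum>m\<in>UNIV. t $ m *\<^sub>R axis m 1)"
      using basis_expansion [of t] by (simp add: scalar_mult_eq_scaleR)
    also have "\<dots> \<in> span (Collect (decomposable D))"
    proof (rule span_sum)
      fix m
      show "t $ m *\<^sub>R axis m 1 \<in> span (Collect (decomposable D))"
      proof (cases "\<forall>i. m i \<in> D i")
        case True
        then show ?thesis by (intro span_scale span_base ax)
      next
        case False
        with t have "t $ m = 0" unfolding tensor_space_def by blast
        then show ?thesis by (simp add: span_zero)
      qed
    qed
    finally show "t \<in> span (Collect (decomposable D))" .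
  qed
qed

text \<open>In the following three definitions \<open>E\<close> is a subspace playing the role of the ambient
  Euclidean space; interiors and polars are relative to it.\<close>

definition convex_body :: "'a::euclidean_space set \<Rightarrow> 'a set \<Rightarrow> bool" where
  "convex_body E C \<longleftrightarrow>
     C \<subseteq> E \<and> compact C \<and> convex C \<and> (top_of_set E) interior_of C \<noteq> {}"

definition symmetric_convex_body :: "'a::euclidean_space set \<Rightarrow> 'a set \<Rightarrow> bool" where
  "symmetric_convex_body E C \<longleftrightarrow> convex_body E C \<and> C = uminus ` C"

definition polar :: "'a::euclidean_space set \<Rightarrow> 'a set \<Rightarrow> 'a set" where
  "polar E C = {y \<in> E. \<forall>x\<in>C. \<bar>x \<bullet> y\<bar> \<le> 1}"

definition projective_tensor ::
    "('l::finite \<Rightarrow> (real ^ 'n::finite) set) \<Rightarrow> (real ^ ('l \<Rightarrow> 'n)) set" where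
  "projective_tensor Q = convex hull {tensor x | x. \<forall>i. x i \<in> Q i}"

definition injective_tensor ::
    "('l::finite \<Rightarrow> 'n::finite set) \<Rightarrow> ('l \<Rightarrow> (real ^ 'n) set) \<Rightarrow> (real ^ ('l \<Rightarrow> 'n)) set" where
  "injective_tensor D Q =
     polar (tensor_space D) (projective_tensor (\<lambda>i. polar (coord_space (D i)) (Q i)))"

definition tensorial_bodies ::
    "('l::finite \<Rightarrow> 'n::finite set) \<Rightarrow> (real ^ ('l \<Rightarrow> 'n)) set set" where
  "tensorial_bodies D =
     {Q. symmetric_convex_body (tensor_space D) Q \<and>
         (\<exists>P. (\<forall>i. symmetric_convex_body (coord_space (D i)) (P i)) \<and>
              projective_tensor P \<subseteq> Q \<and> Q \<subseteq> injective_tensor D P)}"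

text \<open>Only the restriction of \<open>T\<close> to \<open>tensor_space D\<close> is constrained, hence linearity is spelled out
  on that subspace.\<close>

definition GL_tensor ::
    "('l::finite \<Rightarrow> 'n::finite set) \<Rightarrow> (real ^ ('l \<Rightarrow> 'n) \<Rightarrow> real ^ ('l \<Rightarrow> 'n)) set" where
  "GL_tensor D =
     {T. (\<forall>s\<in>tensor_space D. \<forall>t\<in>tensor_space D. T (s + t) = T s + T t) \<and>
         (\<forall>c. \<forall>t\<in>tensor_space D. T (c *\<^sub>R t) = c *\<^sub>R T t) \<and>
         bij_betw T (tensor_space D) (tensor_space D) \<and>
         (\<forall>t. decomposable D t \<longrightarrow> decomposable D (T t))}"

end

theory Submission
  imports Defs
begin

text \<open>
  A linear bijection of the tensor space that preserves decomposable tensors is a tensor product of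
  isomorphisms between the factors, up to a permutation of the factors: there are a permutation
  \<open>\<tau>\<close> of the index set and linear isomorphisms \<open>S i\<close> from the \<open>i\<close>-th factor onto the factor
  \<open>\<tau> i\<close> such that \<open>T (\<Otimes>\<^sub>i x\<^sub>i)\<close> has \<open>S i x\<^sub>i\<close> in position \<open>\<tau> i\<close>
  (\<open>decomposable_preserver_structure\<close>). Once this is known the theorem is formal. If \<open>Q\<close> lies between
  the projective and the injective tensor product of the bodies \<open>P i\<close>, then \<open>T Q\<close> lies between those
  of the bodies \<open>R (\<tau> i) = S i (P i)\<close>: tensors of elements of the \<open>R j\<close> are images of tensors of
  elements of the \<open>P i\<close>, and, passing to adjoints, tensors of elements of the polars of the \<open>R j\<close> are
  pulled back along \<open>T\<close> to tensors of elements of the polars of the \<open>P i\<close>.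

  The structure theorem is proved by looking at the lines spanned by the factors. The sum of two
  decomposable tensors is decomposable only if their factors span different lines in at most one
  position (\<open>decomposable_sum_differs_in_one_factor\<close>). So if one factor of the argument changes, at most
  one of the lines of the image changes: on tuples of lines, \<open>T\<close> induces an injective map that sends
  adjacent tuples, those differing in a single position, to adjacent or equal tuples. Such a map sends
  all changes in position \<open>i\<close> to changes in one and the same position \<open>\<tau> i\<close>
  (\<open>direction_independent_of_base_point\<close>); this is a purely combinatorial fact about triangles and
  squares. Surjectivity of \<open>T\<close> makes \<open>\<tau>\<close> a permutation: in a position missed by \<open>\<tau>\<close> all images would
  share the same factor, and this is where dimension at least two is needed. Finally the maps \<open>S i\<close> are
  read off from the images of tensors that differ from a fixed one in position \<open>i\<close> only. By construction
  \<open>T (\<Otimes>\<^sub>i x\<^sub>i)\<close> is a multiple of the tensor built from the \<open>S i x\<^sub>i\<close>, and linearity in each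
  factor forces all these multiples to be equal to one.
\<close>

section \<open>Changing one coordinate at a time\<close>

lemma eq_if_invariant_under_single_updates:
  fixes X :: "'l::finite \<Rightarrow> 'a set" and P :: "('l \<Rightarrow> 'a) \<Rightarrow> 'b"
  assumes inv: "\<And>x i v. x \<in> Pi UNIV X \<Longrightarrow> v \<in> X i \<Longrightarrow> P (x(i := v)) = P x"
    and x: "x \<in> Pi UNIV X" and y: "y \<in> Pi UNIV X"
  shows "P x = P y"
proof -
  have "P (\<lambda>i. if i \<in> S then y i else x i) = P x" if "finite S" for S
    using that
  proof (induction S)
    case empty
    then show ?case by simp
  next
    case (insert i S)
    let ?z = "\<lambda>k. if k \<in> S then y k else x k"
    have "(\<lambda>k. if k \<in> insert i S then y k else x k) = ?z(i := y i)"
      by auto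
    moreover have "?z \<in> Pi UNIV X" "y i \<in> X i" using x y by (auto simp: Pi_iff)
    ultimately show ?case using inv insert.IH by metis
  qed
  from this [of UNIV] show ?thesis by simp
qed

text \<open>Three tuples on a line in direction \<open>i\<close> are pairwise adjacent. If two of the images differed from the
  third in distinct positions, they would differ from each other in both. Hence the images of a whole
  line vary in one position.\<close>

lemma line_direction_exists:
  fixes X :: "'l::finite \<Rightarrow> 'a set" and h :: "('l \<Rightarrow> 'a) \<Rightarrow> 'k \<Rightarrow> 'b"
  assumes adj: "\<And>x i v. x \<in> Pi UNIV X \<Longrightarrow> v \<in> X i \<Longrightarrow> \<exists>j. \<forall>k. k \<noteq> j \<longrightarrow> h (x(i := v)) k = h x k"
    and x: "x \<in> Pi UNIV X"
  shows "\<exists>j. \<forall>v\<in>X i. \<forall>k. k \<noteq> j \<longrightarrow> h (x(i := v)) k = h x k"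
proof (cases "\<forall>v\<in>X i. h (x(i := v)) = h x")
  case True
  then show ?thesis by auto
next
  case False
  then obtain v where v: "v \<in> X i" "h (x(i := v)) \<noteq> h x" by blast
  then obtain j where j: "h (x(i := v)) j \<noteq> h x j" by blast
  have voff: "h (x(i := v)) k = h x k" if "k \<noteq> j" for k
    using adj [OF x v(1)] j that by metis
  have "h (x(i := w)) k = h x k" if w: "w \<in> X i" and k: "k \<noteq> j" for w k
  proof (rule ccontr)
    assume ne: "h (x(i := w)) k \<noteq> h x k"
    then have "h (x(i := w)) j = h x j"
      using adj [OF x w] k by metis
    moreover have "\<exists>j'. \<forall>k. k \<noteq> j' \<longrightarrow> h (x(i := w)) k = h (x(i := v)) k"
      using adj [of "x(i := v)" w i] x v(1) w by (auto simp: Pi_iff)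
    ultimately show False
      using j ne voff [OF k] k by metis
  qed
  then show ?thesis by blast
qed

text \<open>The map \<open>p\<close> assigns to an entry its class (later: the line it spans), so that the second assumption
  says that \<open>h\<close> is a well-defined injective map on tuples of classes. By the previous lemma every line in
  direction \<open>i\<close> has an image direction. Two parallel lines that differ in one further position \<open>k\<close> form
  squares; in the image of such a square every position that changes along one side must change back
  along another, and if opposite sides had different directions, two opposite corners would collapse,
  against injectivity.\<close>

lemma direction_independent_of_base_point:
  fixes X :: "'l::finite \<Rightarrow> 'a set" and h :: "('l \<Rightarrow> 'a) \<Rightarrow> 'k \<Rightarrow> 'b" and p :: "'a \<Rightarrow> 'c"
  assumes adj: "\<And>x i v. x \<in> Pi UNIV X \<Longrightarrow> v \<in> X i \<Longrightarrow> \<exists>j. \<forall>k. k \<noteq> j \<longrightarrow> h (x(i := v)) k = h x k"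
    and cls: "\<And>x y. x \<in> Pi UNIV X \<Longrightarrow> y \<in> Pi UNIV X \<Longrightarrow> h x = h y \<longleftrightarrow> (\<forall>i. p (x i) = p (y i))"
  shows "\<exists>j. \<forall>x\<in>Pi UNIV X. \<forall>v\<in>X i. \<forall>k. k \<noteq> j \<longrightarrow> h (x(i := v)) k = h x k"
proof (cases "\<exists>v\<in>X i. \<exists>w\<in>X i. p v \<noteq> p w")
  case False
  have "h (x(i := v)) = h x" if "x \<in> Pi UNIV X" "v \<in> X i" for x v
  proof -
    have "p v = p (x i)" using False that by (metis Pi_mem UNIV_I)
    moreover have "x(i := v) \<in> Pi UNIV X" using that by (auto simp: Pi_iff)
    ultimately show ?thesis using cls that(1) by (metis fun_upd_apply)
  qed
  then show ?thesis by simp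
next
  case True
  then obtain v w where v: "v \<in> X i" and w: "w \<in> X i" and vw: "p v \<noteq> p w" by blast
  define dir where "dir x j \<longleftrightarrow> (\<forall>u\<in>X i. \<forall>k. k \<noteq> j \<longrightarrow> h (x(i := u)) k = h x k)" for x j
  have upd: "x(k := u) \<in> Pi UNIV X" if "x \<in> Pi UNIV X" "u \<in> X k" for x k u
    using that by (auto simp: Pi_iff)
  have ex: "\<exists>j. dir x j" if "x \<in> Pi UNIV X" for x
    unfolding dir_def by (rule line_direction_exists [OF adj that])
  have off: "h (x(i := v)) k = h (x(i := w)) k" if "dir x j" "k \<noteq> j" for x j k
    using that v w unfolding dir_def by metis
  have at: "h (x(i := v)) j \<noteq> h (x(i := w)) j" if x: "x \<in> Pi UNIV X" and d: "dir x j" for x j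
  proof
    assume "h (x(i := v)) j = h (x(i := w)) j"
    then have "h (x(i := v)) = h (x(i := w))" using off [OF d] by (metis ext)
    then show False using cls [OF upd [OF x v] upd [OF x w]] vw by (metis fun_upd_same)
  qed
  have uniq: "j = j'" if "x \<in> Pi UNIV X" "dir x j" "dir x j'" for x j j'
    using at off that by metis
  have step: "dir (x(k := u)) j" if x: "x \<in> Pi UNIV X" and u: "u \<in> X k" and d: "dir x j" for x k u j
  proof (cases "k = i")
    case True
    then show ?thesis using d u unfolding dir_def by (metis fun_upd_upd)
  next
    case ki: False
    let ?y = "x(k := u)"
    obtain j' where d': "dir ?y j'" using ex [OF upd [OF x u]] by blast
    have "j = j'"
    proof (rule ccontr)
      assume jj: "j \<noteq> j'"
      let ?a = "x(i := v)" and ?b = "x(i := w)" and ?c = "?y(i := v)" and ?e = "?y(i := w)"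
      have ca: "?c = ?a(k := u)" and eb: "?e = ?b(k := u)"
        using ki by (auto simp: fun_upd_twist)
      have A: "?a \<in> Pi UNIV X" "?b \<in> Pi UNIV X" "?c \<in> Pi UNIV X" "?e \<in> Pi UNIV X"
        using x u v w by (auto simp: Pi_iff)
      obtain k1 where k1: "\<And>n. n \<noteq> k1 \<Longrightarrow> h ?c n = h ?a n"
        using adj [OF A(1) u] unfolding ca by blast
      obtain k2 where k2: "\<And>n. n \<noteq> k2 \<Longrightarrow> h ?e n = h ?b n"
        using adj [OF A(2) u] unfolding eb by blast
      have ab: "\<And>n. n \<noteq> j \<Longrightarrow> h ?a n = h ?b n" "h ?a j \<noteq> h ?b j"
        using off [OF d] at [OF x d] by auto
      have ce: "\<And>n. n \<noteq> j' \<Longrightarrow> h ?c n = h ?e n" "h ?c j' \<noteq> h ?e j'"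
        using off [OF d'] at [OF upd [OF x u] d'] by auto
      have "k1 = j \<or> k2 = j" using ab(2) ce(1) [OF jj] k1 k2 by metis
      moreover have "k1 = j' \<or> k2 = j'" using ce(2) ab(1) [OF jj [symmetric]] k1 k2 by metis
      ultimately consider "k1 = j" "k2 = j'" | "k1 = j'" "k2 = j" using jj by metis
      then show False
      proof cases
        case 1
        \<comment> \<open>The corners \<open>b\<close> and \<open>c\<close> agree off \<open>j\<close> through \<open>a\<close> and off \<open>j'\<close> through \<open>e\<close>.\<close>
        have "h ?b n = h ?c n" for n
        proof (cases "n = j")
          case True
          then show ?thesis using k2 [of n] ce(1) [of n] 1 jj by metis
        next
          case False
          then show ?thesis using k1 [of n] ab(1) [of n] 1 by metis
        qed
        then have "h ?b = h ?c" by (rule ext)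
        then show False using cls [OF A(2,3)] vw by (metis fun_upd_same)
      next
        case 2
        \<comment> \<open>The corners \<open>a\<close> and \<open>e\<close> agree off \<open>j\<close> through \<open>b\<close> and off \<open>j'\<close> through \<open>c\<close>.\<close>
        have "h ?a n = h ?e n" for n
        proof (cases "n = j")
          case True
          then show ?thesis using k1 [of n] ce(1) [of n] 2 jj by metis
        next
          case False
          then show ?thesis using k2 [of n] ab(1) [of n] 2 by metis
        qed
        then have "h ?a = h ?e" by (rule ext)
        then show False using cls [OF A(1,4)] vw by (metis fun_upd_same)
      qed
    qed
    then show ?thesis using d' by simp
  qed
  \<comment> \<open>The image direction is unique, so its transport along single updates is the equality of the
    sets of all image directions, to which the induction principle applies.\<close>
  have inv: "{j. dir (x(k := u)) j} = {j. dir x j}" if x: "x \<in> Pi UNIV X" and u: "u \<in> X k" for x k u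
    using step [OF x u] ex [OF x] uniq [OF upd [OF x u]] by blast
  have const: "{j. dir x j} = {j. dir y j}" if "x \<in> Pi UNIV X" "y \<in> Pi UNIV X" for x y
    by (rule eq_if_invariant_under_single_updates [where P = "\<lambda>x. {j. dir x j}", OF inv that])
  show ?thesis
  proof (cases "Pi UNIV X = {}")
    case False
    then obtain x j where "x \<in> Pi UNIV X" "dir x j" using ex by blast
    then have "\<forall>y\<in>Pi UNIV X. dir y j" using const by blast
    then show ?thesis unfolding dir_def by blast
  qed auto
qed

section \<open>Decomposable tensors\<close>

lemma span_singleton_eq_iff:
  fixes u v :: "'a::real_vector"
  assumes "u \<noteq> 0"
  shows "span {u} = span {v} \<longleftrightarrow> (\<exists>c. c \<noteq> 0 \<and> v = c *\<^sub>R u)"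
proof
  assume eq: "span {u} = span {v}"
  then obtain c where c: "v = c *\<^sub>R u"
    using span_base [of v "{v}"] by (auto simp: span_singleton)
  moreover have "v \<noteq> 0" using eq assms span_base [of u "{u}"] by auto
  ultimately show "\<exists>c. c \<noteq> 0 \<and> v = c *\<^sub>R u" by auto
next
  assume "\<exists>c. c \<noteq> 0 \<and> v = c *\<^sub>R u"
  then obtain c where c: "c \<noteq> 0" "v = c *\<^sub>R u" by blast
  then have "u = (1 / c) *\<^sub>R v" by simp
  then have "u \<in> span {v}" by (metis span_singleton rangeI)
  moreover have "v \<in> span {u}" using c(2) by (auto simp: span_singleton)
  ultimately show "span {u} = span {v}"
    by (intro equalityI span_minimal) (auto simp: subspace_span)
qed

lemma orthogonal_separation:
  fixes u v :: "'a::euclidean_space"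
  assumes "v \<noteq> 0" "span {u} \<noteq> span {v}" "u \<noteq> 0"
  obtains w where "w \<in> span {u, v}" "u \<bullet> w = 0" "v \<bullet> w \<noteq> 0"
proof
  let ?w = "v - ((v \<bullet> u) / (u \<bullet> u)) *\<^sub>R u"
  show uw: "u \<bullet> ?w = 0" using assms by (simp add: inner_diff_right inner_commute)
  show "?w \<in> span {u, v}" by (intro span_diff span_scale span_base) auto
  have "?w \<noteq> 0"
  proof
    assume "?w = 0"
    then have e: "v = ((v \<bullet> u) / (u \<bullet> u)) *\<^sub>R u" by simp
    then have "(v \<bullet> u) / (u \<bullet> u) \<noteq> 0" using assms(1) by (metis scaleR_zero_left)
    then show False using e assms(2,3) span_singleton_eq_iff by blast
  qed
  moreover have "v \<bullet> ?w = ?w \<bullet> ?w" using uw by (simp add: inner_diff_left inner_commute)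
  ultimately show "v \<bullet> ?w \<noteq> 0" by simp
qed

lemma tensor_scale: "tensor (\<lambda>i. c i *\<^sub>R x i) = (\<Prod>i\<in>UNIV. c i) *\<^sub>R tensor x"
  by (simp add: tensor_def vec_eq_iff prod.distrib)

lemma tensor_update_component: "tensor (x(i := v)) $ m = v $ m i * (\<Prod>k\<in>UNIV - {i}. x k $ m k)"
  by (simp add: tensor_def prod.remove [of UNIV i])

lemma linear_tensor_update: "linear (\<lambda>v. tensor (x(i := v)))"
  by (rule linearI) (simp_all add: vec_eq_iff tensor_update_component algebra_simps)

lemma inner_tensor_update:
  "tensor x \<bullet> tensor (y(i := v)) = (x i \<bullet> v) * (\<Prod>k\<in>UNIV - {i}. x k \<bullet> y k)"
  by (simp add: inner_tensor prod.remove [of UNIV i])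

lemma tensor_eq_0_iff: "tensor x = 0 \<longleftrightarrow> (\<exists>i. x i = 0)"
proof -
  have "tensor x = 0 \<longleftrightarrow> tensor x \<bullet> tensor x = 0" by simp
  also have "\<dots> \<longleftrightarrow> (\<exists>i. x i = 0)" by (subst inner_tensor) simp
  finally show ?thesis .
qed

lemma tensor_axis: "tensor (\<lambda>i. axis (m i) 1) = axis m 1"
proof -
  have "(\<Prod>i\<in>UNIV. axis (m i) (1::real) $ k i) = axis m 1 $ k" for k
  proof (cases "k = m")
    case False
    then obtain i where "k i \<noteq> m i" by blast
    then have "(\<Prod>i\<in>UNIV. axis (m i) (1::real) $ k i) = 0"
      by (intro prod_zero) (auto simp: axis_def)
    with False show ?thesis by (simp add: axis_def)
  qed simp
  then show ?thesis by (simp add: tensor_def vec_eq_iff)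
qed

lemma eq_if_inner_tensor_eq:
  assumes "\<And>y. s \<bullet> tensor y = t \<bullet> tensor y"
  shows "s = t"
proof (rule vec_eq_iff [THEN iffD2], rule allI)
  fix m
  show "s $ m = t $ m"
    using assms [of "\<lambda>i. axis (m i) 1"] by (simp add: tensor_axis inner_axis)
qed

text \<open>Pairing both sides with the tensor that agrees with \<open>x\<close> except for a coordinate vector in position
  \<open>k\<close> recovers the \<open>k\<close>-th factors up to non-zero scalars.\<close>

lemma spans_eq_if_tensor_proportional:
  assumes ne: "tensor x \<noteq> 0" and eq: "tensor x = c *\<^sub>R tensor y"
  shows "span {x k} = span {y k}"
proof -
  let ?p = "\<Prod>i\<in>UNIV - {k}. x i \<bullet> x i" and ?q = "\<Prod>i\<in>UNIV - {k}. y i \<bullet> x i"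
  have x0: "x i \<noteq> 0" for i using ne tensor_eq_0_iff by blast
  have y0: "y i \<noteq> 0" for i
  proof -
    have "tensor y \<noteq> 0" using ne eq by auto
    then show ?thesis using tensor_eq_0_iff by blast
  qed
  have p: "?p \<noteq> 0" using x0 by simp
  have "?p * x k $ a = (c * ?q) * y k $ a" for a
  proof -
    have "tensor x \<bullet> tensor (x(k := axis a 1)) = c * (tensor y \<bullet> tensor (x(k := axis a 1)))"
      by (simp add: eq)
    then show ?thesis by (simp add: inner_tensor_update inner_axis mult.commute mult.left_commute)
  qed
  then have e: "?p *\<^sub>R x k = (c * ?q) *\<^sub>R y k" by (simp add: vec_eq_iff)
  have "x k = inverse ?p *\<^sub>R (?p *\<^sub>R x k)" using p by simp
  also have "\<dots> = (c * ?q / ?p) *\<^sub>R y k" by (simp only: e scaleR_scaleR divide_inverse mult.commute)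
  finally obtain d where d: "x k = d *\<^sub>R y k" by blast
  then have "d \<noteq> 0" using x0 [of k] by auto
  then show ?thesis using span_singleton_eq_iff [OF y0, of k "x k"] d by blast
qed

lemma tensor_proportional_if_spans_eq:
  assumes ne: "\<And>i. x i \<noteq> 0" and eq: "\<And>i. span {x i} = span {y i}"
  obtains c where "c \<noteq> 0" "tensor y = c *\<^sub>R tensor x"
proof -
  have "\<forall>i. \<exists>c. c \<noteq> 0 \<and> y i = c *\<^sub>R x i"
    using span_singleton_eq_iff ne eq by blast
  then obtain c where c: "\<And>i. c i \<noteq> 0" "\<And>i. y i = c i *\<^sub>R x i" by metis
  have "y = (\<lambda>i. c i *\<^sub>R x i)" using c(2) by blast
  then have "tensor y = (\<Prod>i\<in>UNIV. c i) *\<^sub>R tensor x" by (simp add: tensor_scale)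
  moreover have "(\<Prod>i\<in>UNIV. c i) \<noteq> 0" using c(1) by simp
  ultimately show ?thesis using that by blast
qed

text \<open>Contracting position \<open>j\<close> with \<open>w\<close> is linear on all tensors. To stay in the same space, the contracted
  tensor is written with the fixed vector \<open>u\<close> in the position that became free.\<close>

lemma tensor_contraction:
  assumes "tensor x + tensor y = tensor z"
  shows "tensor (x(j := (x j \<bullet> w) *\<^sub>R u)) + tensor (y(j := (y j \<bullet> w) *\<^sub>R u))
       = tensor (z(j := (z j \<bullet> w) *\<^sub>R u))"
proof (rule eq_if_inner_tensor_eq)
  fix \<psi>
  have *: "tensor (x(j := (x j \<bullet> w) *\<^sub>R u)) \<bullet> tensor \<psi> = (u \<bullet> \<psi> j) * (tensor x \<bullet> tensor (\<psi>(j := w)))"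
    for x
    by (simp add: inner_tensor prod.remove [of UNIV j])
  show "(tensor (x(j := (x j \<bullet> w) *\<^sub>R u)) + tensor (y(j := (y j \<bullet> w) *\<^sub>R u))) \<bullet> tensor \<psi>
      = tensor (z(j := (z j \<bullet> w) *\<^sub>R u)) \<bullet> tensor \<psi>"
    unfolding inner_add_left * by (simp add: assms [symmetric] inner_add_left algebra_simps)
qed

text \<open>Choose \<open>w\<close> orthogonal to the \<open>j\<close>-th factor of \<open>x\<close> but not to that of \<open>y\<close>. Contraction with \<open>w\<close>
  kills the summand \<open>tensor x\<close>, so outside \<open>j\<close> the factors of \<open>y\<close> and \<open>z\<close> span the same lines. The same
  holds for \<open>x\<close> and \<open>z\<close> by symmetry.\<close>

lemma decomposable_sum_differs_in_one_factor:
  assumes sum: "tensor x + tensor y = tensor z"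
    and x: "\<And>i. x i \<noteq> 0" and y: "\<And>i. y i \<noteq> 0"
    and j: "span {x j} \<noteq> span {y j}" and k: "k \<noteq> j"
  shows "span {x k} = span {y k}"
proof -
  have *: "span {y k} = span {z k}"
    if sum: "tensor x + tensor y = tensor z" and x: "\<And>i. x i \<noteq> 0" and y: "\<And>i. y i \<noteq> 0"
      and j: "span {x j} \<noteq> span {y j}"
    for x y :: "'a \<Rightarrow> real ^ 'b"
  proof -
    obtain w where w: "x j \<bullet> w = 0" "y j \<bullet> w \<noteq> 0"
      using orthogonal_separation [OF y j x] by blast
    let ?y = "y(j := (y j \<bullet> w) *\<^sub>R x j)" and ?z = "z(j := (z j \<bullet> w) *\<^sub>R x j)"
    have "tensor (x(j := (x j \<bullet> w) *\<^sub>R x j)) = 0"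
      using w(1) by (auto simp: tensor_eq_0_iff)
    then have "tensor ?y = 1 *\<^sub>R tensor ?z"
      using tensor_contraction [OF sum, of j w "x j"] by simp
    moreover have "tensor ?y \<noteq> 0" using w(2) x y by (auto simp: tensor_eq_0_iff)
    ultimately have "span {?y k} = span {?z k}" using spans_eq_if_tensor_proportional by blast
    then show ?thesis using k by simp
  qed
  show ?thesis
    using * [OF sum x y j] * [of y x] sum x y j by (metis add.commute)
qed


section \<open>Linear maps that preserve decomposable tensors\<close>

lemma tensor_in_tensor_space:
  assumes "x \<in> Pi UNIV (\<lambda>i. coord_space (D i))"
  shows "tensor x \<in> tensor_space D"
proof -
  have "decomposable D (tensor x)" using assms unfolding decomposable_def by auto
  then show ?thesis using span_base [of "tensor x" "Collect (decomposable D)"]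
    by (simp add: span_decomposable)
qed

lemma tensor_space_induct:
  assumes "linear f" "linear g"
    and "\<And>x. x \<in> Pi UNIV (\<lambda>i. coord_space (D i)) \<Longrightarrow> f (tensor x) = g (tensor x)"
    and "t \<in> tensor_space D"
  shows "f t = g t"
proof (rule linear_eq_on_span [OF assms(1,2)])
  show "t \<in> span (Collect (decomposable D))" using assms(4) by (simp add: span_decomposable)
qed (use assms(3) in \<open>auto simp: decomposable_def\<close>)

lemma exists_nonparallel_in_coord_space:
  assumes "2 \<le> card S"
  obtains v where "v \<in> coord_space S" "v \<noteq> 0" "span {u} \<noteq> span {v}"
proof -
  have "\<not> coord_space S \<subseteq> span {u}"
  proof
    assume "coord_space S \<subseteq> span {u}"
    then have "dim (coord_space S) \<le> dim (span {u})" by (rule dim_subset)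
    also have "\<dots> \<le> card {u}" unfolding dim_span by (rule dim_le_card') simp
    finally show False using assms by (simp add: dim_coord_space)
  qed
  then obtain v where v: "v \<in> coord_space S" "v \<notin> span {u}" by blast
  then have "v \<noteq> 0" "span {u} \<noteq> span {v}"
    using span_zero span_base [of v "{v}"] by auto
  with v show ?thesis using that by blast
qed

text \<open>The tuple \<open>Y x\<close> is any choice of factors of \<open>T (tensor x)\<close>; only the lines spanned by its entries are
  determined by \<open>x\<close>. The lemma is the passage from \<open>T\<close> to the combinatorial situation, followed by the
  proof that \<open>\<tau>\<close> is a permutation.\<close>

lemma preserver_direction_permutation:
  fixes D :: "'l::finite \<Rightarrow> 'n::finite set"
    and Y :: "('l \<Rightarrow> real ^ 'n) \<Rightarrow> 'l \<Rightarrow> real ^ 'n"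
  defines "X \<equiv> \<lambda>i. coord_space (D i) - {0}"
  assumes card: "\<And>i. card (D i) \<ge> 2"
    and T: "linear T" "inj_on T (tensor_space D)" "T ` tensor_space D = tensor_space D"
    and Y: "\<And>x. x \<in> Pi UNIV X \<Longrightarrow> Y x \<in> Pi UNIV X \<and> T (tensor x) = tensor (Y x)"
  obtains \<tau> :: "'l \<Rightarrow> 'l" where "bij \<tau>"
    "\<And>x i v k. x \<in> Pi UNIV X \<Longrightarrow> v \<in> X i \<Longrightarrow> k \<noteq> \<tau> i \<Longrightarrow> span {Y (x(i := v)) k} = span {Y x k}"
proof -
  define h where "h x k = span {Y x k}" for x k
  have X: "x i \<in> coord_space (D i)" "x i \<noteq> 0" if "x \<in> Pi UNIV X" for x i
    using that unfolding X_def by auto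
  have XI: "x \<in> Pi UNIV X" if "\<And>i. x i \<in> coord_space (D i)" "\<And>i. x i \<noteq> 0" for x
    using that unfolding X_def by auto
  have ts: "tensor x \<in> tensor_space D" if "x \<in> Pi UNIV X" for x
    using X that by (intro tensor_in_tensor_space) auto
  have Y0: "Y x i \<noteq> 0" if "x \<in> Pi UNIV X" for x i
    using X(2) Y that by blast
  have cls: "h x = h y \<longleftrightarrow> (\<forall>i. span {x i} = span {y i})"
    if x: "x \<in> Pi UNIV X" and y: "y \<in> Pi UNIV X" for x y
  proof
    assume "h x = h y"
    then have "span {Y x i} = span {Y y i}" for i unfolding h_def by metis
    then obtain c where "tensor (Y y) = c *\<^sub>R tensor (Y x)"
      using tensor_proportional_if_spans_eq [of "Y x" "Y y"] Y0 [OF x] by metis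
    then have "T (tensor y) = T (c *\<^sub>R tensor x)"
      using Y x y by (simp add: linear_scale [OF T(1)])
    then have "tensor y = c *\<^sub>R tensor x"
      using T(2) ts [OF x] ts [OF y] subspace_scale [OF subspace_tensor_space]
      by (auto dest: inj_onD)
    moreover have "tensor y \<noteq> 0" using X(2) [OF y] by (simp add: tensor_eq_0_iff)
    ultimately show "\<forall>i. span {x i} = span {y i}"
      using spans_eq_if_tensor_proportional by metis
  next
    assume "\<forall>i. span {x i} = span {y i}"
    then obtain c where "tensor y = c *\<^sub>R tensor x"
      using tensor_proportional_if_spans_eq [of x y] X(2) [OF x] by metis
    then have "tensor (Y y) = c *\<^sub>R tensor (Y x)"
      using Y x y by (metis linear_scale [OF T(1)])
    moreover have "tensor (Y y) \<noteq> 0" using Y0 [OF y] by (simp add: tensor_eq_0_iff)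
    ultimately have "span {Y y i} = span {Y x i}" for i
      using spans_eq_if_tensor_proportional by metis
    then show "h x = h y" unfolding h_def by auto
  qed
  have adj: "\<exists>j. \<forall>k. k \<noteq> j \<longrightarrow> h (x(i := v)) k = h x k"
    if x: "x \<in> Pi UNIV X" and v: "v \<in> X i" for x i v
  proof (cases "span {v} = span {x i}")
    case True
    have "x(i := v) \<in> Pi UNIV X" using x v by (auto simp: Pi_iff)
    then have "h (x(i := v)) = h x" using cls x True by (metis fun_upd_apply)
    then show ?thesis by simp
  next
    case False
    let ?x = "x(i := v)" and ?z = "x(i := v + x i)"
    have "v + x i \<noteq> 0"
    proof
      assume "v + x i = 0"
      then have "x i = (-1) *\<^sub>R v" by (simp add: add_eq_0_iff)
      moreover have "v \<noteq> 0" using v by (simp add: X_def)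
      ultimately have "span {v} = span {x i}"
        by (subst span_singleton_eq_iff) (auto intro: exI [of _ "-1"])
      then show False using False by blast
    qed
    moreover have "v + x i \<in> coord_space (D i)"
      using v X(1) [OF x] subspace_add [OF subspace_coord_space] by (auto simp: X_def)
    ultimately have z: "?z \<in> Pi UNIV X" using x by (auto simp: Pi_iff X_def)
    have x': "?x \<in> Pi UNIV X" using x v by (auto simp: Pi_iff)
    have "tensor ?x + tensor x = tensor ?z"
      using linear_add [OF linear_tensor_update, of x i v "x i"] by simp
    then have "T (tensor ?x) + T (tensor x) = T (tensor ?z)"
      by (metis linear_add [OF T(1)])
    then have sum: "tensor (Y ?x) + tensor (Y x) = tensor (Y ?z)"
      using Y x x' z by metis
    show ?thesis
    proof (cases "h ?x = h x")
      case False
      then obtain j where "h ?x j \<noteq> h x j" by blast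
      then have "\<forall>k. k \<noteq> j \<longrightarrow> h ?x k = h x k"
        using decomposable_sum_differs_in_one_factor [OF sum Y0 [OF x'] Y0 [OF x]]
        unfolding h_def by blast
      then show ?thesis by blast
    qed simp
  qed
  have "\<forall>i. \<exists>j. \<forall>x\<in>Pi UNIV X. \<forall>v\<in>X i. \<forall>k. k \<noteq> j \<longrightarrow> h (x(i := v)) k = h x k"
    by (intro allI direction_independent_of_base_point [where p = "\<lambda>v. span {v}"] adj cls)
  then obtain \<tau> where \<tau>: "\<And>x i v k. x \<in> Pi UNIV X \<Longrightarrow> v \<in> X i \<Longrightarrow> k \<noteq> \<tau> i \<Longrightarrow> h (x(i := v)) k = h x k"
    by metis
  have ne: "\<exists>v. v \<in> coord_space (D i) \<and> v \<noteq> 0 \<and> span {u} \<noteq> span {v}" for i u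
    using exists_nonparallel_in_coord_space [OF card] by metis
  have "surj \<tau>"
  proof (rule ccontr)
    assume "\<not> surj \<tau>"
    then obtain j where j: "\<And>i. j \<noteq> \<tau> i" by (metis surjI surj_def)
    \<comment> \<open>In a position \<open>j\<close> missed by \<open>\<tau>\<close> all images share the line of \<open>Y e j\<close>, so a tensor with a
      factor orthogonal to it in position \<open>j\<close> is orthogonal to the range of \<open>T\<close>, though it lies in it.\<close>
    have "\<forall>i. \<exists>v. v \<in> X i" using ne unfolding X_def by blast
    then obtain e where "\<forall>i. e i \<in> X i" by metis
    then have e: "e \<in> Pi UNIV X" by simp
    have const: "h x j = h e j" if "x \<in> Pi UNIV X" for x
      by (rule eq_if_invariant_under_single_updates [where P = "\<lambda>x. h x j", OF \<tau> that e]) (assumption | rule j)+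
    obtain v where v: "v \<in> coord_space (D j)" "v \<noteq> 0" "span {Y e j} \<noteq> span {v}"
      using ne by blast
    obtain w where w: "w \<in> span {Y e j, v}" "Y e j \<bullet> w = 0" "v \<bullet> w \<noteq> 0"
      using orthogonal_separation [OF v(2,3) Y0 [OF e]] by blast
    have "Y e j \<in> coord_space (D j)" using Y [OF e] X(1) by blast
    then have "span {Y e j, v} \<subseteq> coord_space (D j)"
      using v(1) by (intro span_minimal subspace_coord_space) auto
    then have wD: "w \<in> coord_space (D j)" using w(1) by blast
    let ?\<psi> = "tensor (e(j := w))"
    have \<psi>: "?\<psi> \<in> tensor_space D"
      using wD X(1) [OF e] by (intro tensor_in_tensor_space) auto
    have vanish: "?\<psi> \<bullet> T (tensor x) = 0" if "x \<in> Pi UNIV (\<lambda>i. coord_space (D i))" for x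
    proof (cases "\<exists>i. x i = 0")
      case True
      then have "tensor x = 0" by (simp add: tensor_eq_0_iff)
      then show ?thesis by (simp add: linear_0 [OF T(1)])
    next
      case False
      then have x: "x \<in> Pi UNIV X" using that by (intro XI) auto
      then obtain c where "Y x j = c *\<^sub>R Y e j"
        using const [OF x] span_singleton_eq_iff [OF Y0 [OF e]] unfolding h_def by metis
      then have "tensor (Y x) \<bullet> ?\<psi> = 0" using w(2) by (simp add: inner_tensor_update)
      then show ?thesis using Y [OF x] by (simp add: inner_commute)
    qed
    have "?\<psi> \<bullet> T t = 0" if "t \<in> tensor_space D" for t
    proof (rule tensor_space_induct [where f = "\<lambda>t. ?\<psi> \<bullet> T t" and g = "\<lambda>t. 0", OF _ _ vanish that])
      show "linear (\<lambda>t. ?\<psi> \<bullet> T t)"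
        by (rule linearI) (simp_all add: inner_add_right linear_add [OF T(1)] linear_scale [OF T(1)])
    qed (auto intro: linearI)
    then have "?\<psi> \<bullet> ?\<psi> = 0" using \<psi> T(3) by (metis imageE)
    moreover have "w \<noteq> 0" using w(3) by auto
    ultimately show False using X(2) [OF e] by (auto simp: tensor_eq_0_iff split: if_splits)
  qed
  then have "bij \<tau>" by (simp add: bij_def finite_UNIV_surj_inj)
  then show ?thesis using that \<tau> unfolding h_def by blast
qed

text \<open>If \<open>A\<close> and \<open>B\<close> are proportional at every vector, the factor of proportionality is constant: at
  linearly independent \<open>v\<close> and \<open>w\<close> it is compared with the one at \<open>v + w\<close>. Here the factor is known to
  be one at \<open>v\<close>.\<close>

lemma proportional_linear_maps:
  fixes A B :: "'a::real_vector \<Rightarrow> 'b::real_vector"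
  assumes A: "linear A" and B: "linear B"
    and S: "subspace S" and ratio: "\<And>v. v \<in> S \<Longrightarrow> \<exists>c. A v = c *\<^sub>R B v"
    and inj: "\<And>v. v \<in> S \<Longrightarrow> B v = 0 \<Longrightarrow> v = 0"
    and v: "v \<in> S" "v \<noteq> 0" "A v = B v" and w: "w \<in> S"
  shows "A w = B w"
proof (cases "\<exists>a. w = a *\<^sub>R v")
  case True
  then show ?thesis using v(3) by (auto simp: linear_scale [OF A] linear_scale [OF B])
next
  case False
  obtain c where c: "A w = c *\<^sub>R B w" using ratio [OF w] by blast
  obtain d where d: "A (v + w) = d *\<^sub>R B (v + w)"
    using ratio [OF subspace_add [OF S v(1) w]] by blast
  have "B ((1 - d) *\<^sub>R v + (c - d) *\<^sub>R w) = 0"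
    using c d v(3)
    by (simp only: linear_add [OF A] linear_add [OF B] linear_scale [OF B])
      (simp add: algebra_simps)
  then have z: "(1 - d) *\<^sub>R v + (c - d) *\<^sub>R w = 0"
    by (intro inj subspace_add [OF S] subspace_scale [OF S] v w)
  have "c = d"
  proof (rule ccontr)
    assume cd: "c \<noteq> d"
    have "(c - d) *\<^sub>R w = (d - 1) *\<^sub>R v"
      using z by (simp add: algebra_simps add_eq_0_iff)
    then have "inverse (c - d) *\<^sub>R ((c - d) *\<^sub>R w) = inverse (c - d) *\<^sub>R ((d - 1) *\<^sub>R v)" by simp
    then show False using cd False by auto
  qed
  then have "d = 1" using z v(2) by simp
  then show ?thesis using c \<open>c = d\<close> by simp
qed

lemma tensor_collect_scalars:
  assumes "\<And>k. k \<noteq> j \<Longrightarrow> y k = c k *\<^sub>R f k"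
  shows "tensor y = tensor (f(j := (\<Prod>k\<in>UNIV - {j}. c k) *\<^sub>R y j))"
proof (rule vec_eq_iff [THEN iffD2], rule allI)
  fix m
  have "(\<Prod>k\<in>UNIV - {j}. y k $ m k) = (\<Prod>k\<in>UNIV - {j}. c k * f k $ m k)"
    using assms by (intro prod.cong) auto
  then show "tensor y $ m = tensor (f(j := (\<Prod>k\<in>UNIV - {j}. c k) *\<^sub>R y j)) $ m"
    using tensor_update_component [of y j "y j" m]
    by (simp add: tensor_update_component prod.distrib)
qed

text \<open>Fix a tuple \<open>e\<close> of non-zero vectors with \<open>T (tensor e) = tensor f\<close>. Replacing \<open>e i\<close> by \<open>v\<close> changes,
  up to scalars, only the factor of \<open>f\<close> in position \<open>\<tau> i\<close>; all scalars are moved into that factor, which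
  is then a linear function \<open>S i v\<close>.\<close>

lemma decomposable_preserver_structure:
  fixes D :: "'l::finite \<Rightarrow> 'n::finite set"
  assumes card: "\<And>i. card (D i) \<ge> 2"
    and T: "linear T" "inj_on T (tensor_space D)" "T ` tensor_space D = tensor_space D"
    and dec: "\<And>t. decomposable D t \<Longrightarrow> decomposable D (T t)"
  shows "\<exists>(\<tau> :: 'l \<Rightarrow> 'l) (S :: 'l \<Rightarrow> real ^ 'n \<Rightarrow> real ^ 'n). bij \<tau> \<and>
    (\<forall>i. linear (S i) \<and> inj_on (S i) (coord_space (D i)) \<and>
         S i ` coord_space (D i) = coord_space (D (\<tau> i))) \<and>
    (\<forall>x\<in>Pi UNIV (\<lambda>i. coord_space (D i)).
         T (tensor x) = tensor (\<lambda>j. S (inv \<tau> j) (x (inv \<tau> j))))"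
proof -
  define X where "X i = coord_space (D i) - {0}" for i
  have X: "x i \<in> coord_space (D i)" "x i \<noteq> 0" if "x \<in> Pi UNIV X" for x i
    using that unfolding X_def by auto
  have XI: "x \<in> Pi UNIV X" if "\<And>i. x i \<in> coord_space (D i)" "\<And>i. x i \<noteq> 0" for x
    using that unfolding X_def by auto
  have XU: "x(i := v) \<in> Pi UNIV X" if "x \<in> Pi UNIV X" "v \<in> X i" for x i v
    using that by (auto simp: Pi_iff)
  have "\<exists>y. y \<in> Pi UNIV X \<and> T (tensor x) = tensor y" if x: "x \<in> Pi UNIV X" for x
  proof -
    have "decomposable D (tensor x)" using X(1) [OF x] unfolding decomposable_def by blast
    then obtain y where y: "\<And>i. y i \<in> coord_space (D i)" "T (tensor x) = tensor y"
      using dec unfolding decomposable_def by blast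
    have "tensor x \<in> tensor_space D" using X(1) [OF x] by (intro tensor_in_tensor_space) auto
    moreover have "tensor x \<noteq> 0" using X(2) [OF x] by (simp add: tensor_eq_0_iff)
    ultimately have "T (tensor x) \<noteq> 0"
      using T(2) linear_0 [OF T(1)] subspace_0 [OF subspace_tensor_space] by (metis inj_onD)
    then show ?thesis using y XI by (metis tensor_eq_0_iff)
  qed
  then obtain Y where Y: "\<And>x. x \<in> Pi UNIV X \<Longrightarrow> Y x \<in> Pi UNIV X \<and> T (tensor x) = tensor (Y x)"
    by metis
  obtain \<tau> where \<tau>: "bij \<tau>"
    and dir: "\<And>x i v k. x \<in> Pi UNIV X \<Longrightarrow> v \<in> X i \<Longrightarrow> k \<noteq> \<tau> i \<Longrightarrow> span {Y (x(i := v)) k} = span {Y x k}"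
    using preserver_direction_permutation [OF card T, of Y] Y unfolding X_def by blast
  have inv\<tau> [simp]: "\<tau> (inv \<tau> j) = j" "inv \<tau> (\<tau> i) = i" for i j
    using \<tau> by (simp_all add: bij_is_surj surj_f_inv_f bij_is_inj)
  have "\<forall>i. \<exists>v. v \<in> X i"
    unfolding X_def using exists_nonparallel_in_coord_space [OF card] by (metis Diff_iff singletonD)
  then obtain e where "\<forall>i. e i \<in> X i" by metis
  then have e: "e \<in> Pi UNIV X" by simp
  define f where "f = Y e"
  have f: "f \<in> Pi UNIV X" "T (tensor e) = tensor f" using Y [OF e] unfolding f_def by auto
  define q where "q j = (\<Prod>k\<in>UNIV - {j}. f k \<bullet> f k)" for j
  have q: "q j \<noteq> 0" for j using X(2) [OF f(1)] unfolding q_def by simp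
  \<comment> \<open>An explicit formula for the factor \<open>z\<close> in \<open>T (tensor (e(i := v))) = tensor (f(\<tau> i := z))\<close>: its
    coordinates are found by pairing with \<open>f\<close> in the other positions. Linearity in \<open>v\<close> is then evident.\<close>
  define S where
    "S i v = (\<chi> a. (T (tensor (e(i := v))) \<bullet> tensor (f(\<tau> i := axis a 1))) / q (\<tau> i))" for i v
  have linS: "linear (S i)" for i
  proof -
    have *: "linear (\<lambda>v. T (tensor (e(i := v))))"
      using linear_compose [OF linear_tensor_update T(1)] by (simp add: o_def)
    show ?thesis unfolding S_def
      by (rule linearI)
        (simp_all add: vec_eq_iff linear_add [OF *] linear_scale [OF *] inner_add_left add_divide_distrib)
  qed
  have S_eq: "S i v = z" if "T (tensor (e(i := v))) = tensor (f(\<tau> i := z))" for i v z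
  proof -
    have "(\<Prod>k\<in>UNIV - {\<tau> i}. (f(\<tau> i := z)) k \<bullet> f k) = q (\<tau> i)"
      unfolding q_def by (intro prod.cong) auto
    then show ?thesis
      using q unfolding S_def that inner_tensor_update by (simp add: inner_axis vec_eq_iff)
  qed
  have S: "S i v \<in> X (\<tau> i)" "span {Y (e(i := v)) (\<tau> i)} = span {S i v}" if v: "v \<in> X i" for i v
  proof -
    let ?y = "Y (e(i := v))"
    have y: "?y \<in> Pi UNIV X" "T (tensor (e(i := v))) = tensor ?y" using Y XU [OF e v] by auto
    have "\<forall>k. k \<noteq> \<tau> i \<longrightarrow> (\<exists>c. c \<noteq> 0 \<and> ?y k = c *\<^sub>R f k)"
      using dir [OF e v] span_singleton_eq_iff X(2) [OF f(1)] unfolding f_def by metis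
    then obtain c where c: "\<And>k. k \<noteq> \<tau> i \<Longrightarrow> c k \<noteq> 0" "\<And>k. k \<noteq> \<tau> i \<Longrightarrow> ?y k = c k *\<^sub>R f k"
      by metis
    let ?c = "\<Prod>k\<in>UNIV - {\<tau> i}. c k"
    have c0: "?c \<noteq> 0" using c(1) by simp
    have Sv: "S i v = ?c *\<^sub>R ?y (\<tau> i)"
      using tensor_collect_scalars [of "\<tau> i" ?y c f] c(2) y(2) by (intro S_eq) simp
    have y': "?y (\<tau> i) \<in> coord_space (D (\<tau> i))" "?y (\<tau> i) \<noteq> 0" using X [OF y(1)] by auto
    then show "S i v \<in> X (\<tau> i)"
      using Sv c0 subspace_scale [OF subspace_coord_space] unfolding X_def by auto
    show "span {?y (\<tau> i)} = span {S i v}"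
      using c0 Sv span_singleton_eq_iff [OF y'(2)] by blast
  qed
  have S0: "S i 0 = 0" for i using linear_0 [OF linS] .
  have inX: "S (inv \<tau> j) (x (inv \<tau> j)) \<in> X j" if "x \<in> Pi UNIV X" for x j
    using S(1) [of "x (inv \<tau> j)" "inv \<tau> j"] that by auto
  define G where "G x = tensor (\<lambda>j. S (inv \<tau> j) (x (inv \<tau> j)))" for x
  \<comment> \<open>The line in position \<open>j\<close> depends on the entry of \<open>x\<close> in position \<open>inv \<tau> j\<close> only, so all other
    entries may be moved to those of \<open>e\<close> while this one is kept fixed.\<close>
  have lines: "span {Y x j} = span {S (inv \<tau> j) (x (inv \<tau> j))}" if x: "x \<in> Pi UNIV X" for x j
  proof -
    let ?i = "inv \<tau> j"
    let ?Z = "X(?i := {x ?i})"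
    have xi: "x ?i \<in> X ?i" using x by auto
    have sub: "z \<in> Pi UNIV X" if "z \<in> Pi UNIV ?Z" for z
    proof (rule Pi_I)
      fix i
      have "z i \<in> ?Z i" using that by (rule Pi_mem) simp
      then show "z i \<in> X i" using xi by (cases "i = ?i") simp_all
    qed
    have "span {Y x j} = span {Y (e(?i := x ?i)) j}"
    proof (rule eq_if_invariant_under_single_updates [where X = ?Z and P = "\<lambda>x. span {Y x j}"])
      fix z i v
      assume z: "z \<in> Pi UNIV ?Z" and v: "v \<in> ?Z i"
      show "span {Y (z(i := v)) j} = span {Y z j}"
      proof (cases "i = ?i")
        case True
        moreover have "z i \<in> ?Z i" using z by (rule Pi_mem) simp
        ultimately have "z i = v" using v by simp
        then show ?thesis by (metis fun_upd_triv)
      next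
        case False
        then have "j \<noteq> \<tau> i" "v \<in> X i" using v by (metis inv\<tau>(2), simp)
        then show ?thesis using dir sub [OF z] by blast
      qed
    qed (use x e in \<open>simp_all add: Pi_iff\<close>)
    also have "\<dots> = span {S ?i (x ?i)}" using S(2) [OF xi] by simp
    finally show ?thesis .
  qed
  have prop_G: "\<exists>c. T (tensor x) = c *\<^sub>R G x" if x: "x \<in> Pi UNIV X" for x
  proof -
    let ?F = "\<lambda>j. S (inv \<tau> j) (x (inv \<tau> j))"
    have "?F j \<noteq> 0" for j using inX [OF x] unfolding X_def by blast
    then obtain c where "tensor (Y x) = c *\<^sub>R G x"
      unfolding G_def using lines [OF x]
      by (rule tensor_proportional_if_spans_eq [of ?F "Y x", OF _ sym])
    then show ?thesis using Y [OF x] by auto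
  qed
  have G_upd: "G (x(i := v)) = tensor ((\<lambda>j. S (inv \<tau> j) (x (inv \<tau> j)))(\<tau> i := S i v))" for x i v
    unfolding G_def by (rule arg_cong [where f = tensor]) (use inv\<tau> in \<open>auto simp: fun_eq_iff\<close>)
  have G0: "G x = 0" if "x i = 0" for x i
    unfolding G_def tensor_eq_0_iff using that S0 by (intro exI [of _ "\<tau> i"]) simp
  have step: "T (tensor (x(i := w))) = G (x(i := w))"
    if x: "x \<in> Pi UNIV X" and w: "w \<in> X i" and eq: "T (tensor x) = G x" for x i w
  proof (rule proportional_linear_maps [where A = "\<lambda>v. T (tensor (x(i := v)))"
        and B = "\<lambda>v. G (x(i := v))" and v = "x i"])
    show "linear (\<lambda>v. T (tensor (x(i := v))))"
      using linear_compose [OF linear_tensor_update T(1)] by (simp add: o_def)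
    show "linear (\<lambda>v. G (x(i := v)))"
      unfolding G_upd using linear_compose [OF linS linear_tensor_update] by (simp add: o_def)
    show "subspace (coord_space (D i))" by (rule subspace_coord_space)
    show "x i \<in> coord_space (D i)" "x i \<noteq> 0" using X [OF x] by auto
    show "T (tensor (x(i := x i))) = G (x(i := x i))" using eq by simp
    show "w \<in> coord_space (D i)" using w unfolding X_def by auto
    fix v
    assume v: "v \<in> coord_space (D i)"
    show "\<exists>c. T (tensor (x(i := v))) = c *\<^sub>R G (x(i := v))"
    proof (cases "v = 0")
      case True
      then have "tensor (x(i := v)) = 0" by (auto simp: tensor_eq_0_iff)
      then show ?thesis by (intro exI [of _ 0]) (simp add: linear_0 [OF T(1)])
    next
      case False
      then show ?thesis using prop_G XU x v unfolding X_def by blast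
    qed
    show "v = 0" if "G (x(i := v)) = 0"
    proof (rule ccontr)
      assume "v \<noteq> 0"
      then have "x(i := v) \<in> Pi UNIV X" using XU x v unfolding X_def by blast
      then show False
        using inX that unfolding G_def tensor_eq_0_iff X_def by blast
    qed
  qed
  have "T (tensor e) = G e"
  proof -
    have "S (inv \<tau> j) (e (inv \<tau> j)) = f j" for j by (rule S_eq) (simp add: f(2))
    then show ?thesis unfolding G_def by (simp add: f(2))
  qed
  then have nz: "T (tensor x) = G x" if x: "x \<in> Pi UNIV X" for x
  proof -
    have "(T (tensor x) = G x) = (T (tensor e) = G e)"
    proof (rule eq_if_invariant_under_single_updates [OF _ x e])
      fix x i v
      assume x: "x \<in> Pi UNIV X" and v: "v \<in> X i"
      show "(T (tensor (x(i := v))) = G (x(i := v))) = (T (tensor x) = G x)"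
        using step [OF x v] step [OF XU [OF x v], of "x i" i] x by auto
    qed
    then show ?thesis using \<open>T (tensor e) = G e\<close> by simp
  qed
  have all: "T (tensor x) = G x" if x: "x \<in> Pi UNIV (\<lambda>i. coord_space (D i))" for x
  proof (cases "\<exists>i. x i = 0")
    case True
    then have "tensor x = 0" "G x = 0" using G0 by (auto simp: tensor_eq_0_iff)
    then show ?thesis by (simp add: linear_0 [OF T(1)])
  next
    case False
    then show ?thesis using x by (intro nz XI) auto
  qed
  have inj: "inj_on (S i) (coord_space (D i))" for i
    using S(1) unfolding X_def
    by (intro linear_inj_on_iff_eq_0 [OF linS, THEN iffD2] subspace_coord_space) blast
  have sub: "S i ` coord_space (D i) \<subseteq> coord_space (D (\<tau> i))" for i
    using S(1) S0 subspace_0 [OF subspace_coord_space] unfolding X_def by fastforce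
  have dimS: "dim (S i ` coord_space (D i)) = card (D i)" for i
    using dim_image_eq [of "S i" "coord_space (D i)"] linS inj
    by (simp add: dim_coord_space span_eq_iff [THEN iffD2, OF subspace_coord_space])
  \<comment> \<open>Injectivity bounds the dimensions along \<open>\<tau>\<close>; since \<open>\<tau>\<close> permutes them, their sums agree and all
    bounds are equalities.\<close>
  have le: "card (D i) \<le> card (D (\<tau> i))" for i
    using dim_subset [OF sub, of i] by (simp add: dimS dim_coord_space)
  have "(\<Sum>i\<in>UNIV. card (D (\<tau> i))) = (\<Sum>i\<in>UNIV. card (D i))"
    using sum.reindex_bij_betw [of \<tau> UNIV UNIV "\<lambda>i. card (D i)"] \<tau> by simp
  then have "card (D i) = card (D (\<tau> i))" for i
    using sum_mono_inv [of "\<lambda>i. card (D i)" UNIV "\<lambda>i. card (D (\<tau> i))" i] le by simp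
  then have img: "S i ` coord_space (D i) = coord_space (D (\<tau> i))" for i
    using subspace_dim_equal [OF linear_subspace_image [OF linS subspace_coord_space] subspace_coord_space sub, of i]
    by (simp add: dimS dim_coord_space)
  show ?thesis
    using \<tau> linS inj img all unfolding G_def by (intro exI [of _ \<tau>] exI [of _ S]) simp
qed

section \<open>Images of symmetric convex bodies\<close>

text \<open>Interiors are relative to \<open>E\<close>, and in finite dimension a linear map that is injective on \<open>E\<close> is a
  homeomorphism onto its image, since it has a linear and hence continuous left inverse.\<close>

lemma symmetric_convex_body_linear_image:
  fixes f :: "'a::euclidean_space \<Rightarrow> 'b::euclidean_space"
  assumes f: "linear f" "inj_on f E" "f ` E = E'" and E: "subspace E"
    and C: "symmetric_convex_body E C"
  shows "symmetric_convex_body E' (f ` C)"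
proof -
  have sub: "C \<subseteq> E" and cpt: "compact C" and cvx: "convex C" and sym: "C = uminus ` C"
    and int: "(top_of_set E) interior_of C \<noteq> {}"
    using C unfolding symmetric_convex_body_def convex_body_def by auto
  obtain g where g: "linear g" "\<And>x. x \<in> E \<Longrightarrow> g (f x) = x"
    using linear_exists_left_inverse_on [OF f(1) E f(2)] by auto
  have hom: "homeomorphism E E' f g"
    unfolding homeomorphism_def using f(3) g
    by (force simp: linear_continuous_on linear_conv_bounded_linear [symmetric] f(1))
  obtain U where U: "openin (top_of_set E) U" "U \<subseteq> C" "U \<noteq> {}"
    using int openin_interior_of interior_of_subset by metis
  have "f ` U \<subseteq> (top_of_set E') interior_of (f ` C)"
    using U homeomorphism_imp_open_map [OF hom U(1)] by (intro interior_of_maximal) auto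
  then have "(top_of_set E') interior_of (f ` C) \<noteq> {}" using U(3) by auto
  moreover have "compact (f ` C)"
    using cpt f(1) by (intro compact_continuous_image linear_continuous_on)
      (auto simp: linear_conv_bounded_linear)
  moreover have "convex (f ` C)" by (rule convex_linear_image [OF f(1) cvx])
  moreover have "f ` C = uminus ` f ` C"
    by (subst sym) (simp add: image_image linear_neg [OF f(1)])
  moreover have "f ` C \<subseteq> E'" using sub f(3) by auto
  ultimately show ?thesis unfolding symmetric_convex_body_def convex_body_def by blast
qed

definition coord_projection :: "'n set \<Rightarrow> real ^ 'n::finite \<Rightarrow> real ^ 'n" where
  "coord_projection S x = (\<chi> j. if j \<in> S then x $ j else 0)"

lemma coord_projection_in: "coord_projection S x \<in> coord_space S"
  by (simp add: coord_projection_def coord_space_def)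

lemma inner_coord_projection:
  assumes "x \<in> coord_space S"
  shows "x \<bullet> coord_projection S y = x \<bullet> y"
  unfolding inner_vec_def
  by (rule sum.cong) (use assms in \<open>auto simp: coord_projection_def coord_space_def\<close>)

lemma projective_tensor_le:
  assumes "convex C" "\<And>x. (\<And>i. x i \<in> Q i) \<Longrightarrow> tensor x \<in> C"
  shows "projective_tensor Q \<subseteq> C"
  unfolding projective_tensor_def using assms by (intro hull_minimal) auto

lemma tensor_in_projective_tensor:
  assumes "\<And>i. x i \<in> Q i"
  shows "tensor x \<in> projective_tensor Q"
  unfolding projective_tensor_def using assms by (intro hull_inc) auto

text \<open>The bound against a fixed \<open>t\<close> defines a convex set, so it need only be tested on the tensors that
  generate the projective tensor product of the polars.\<close>

lemma injective_tensor_iff: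
  "t \<in> injective_tensor D Q \<longleftrightarrow> t \<in> tensor_space D \<and>
     (\<forall>\<phi>. (\<forall>i. \<phi> i \<in> polar (coord_space (D i)) (Q i)) \<longrightarrow> \<bar>tensor \<phi> \<bullet> t\<bar> \<le> 1)"
proof -
  have "convex {s. \<bar>s \<bullet> t\<bar> \<le> 1}"
  proof -
    have "{s. \<bar>s \<bullet> t\<bar> \<le> 1} = {s. t \<bullet> s \<le> 1} \<inter> {s. t \<bullet> s \<ge> - 1}"
      by (auto simp: inner_commute)
    then show ?thesis by (simp add: convex_Int convex_halfspace_le convex_halfspace_ge)
  qed
  then have "projective_tensor (\<lambda>i. polar (coord_space (D i)) (Q i)) \<subseteq> {s. \<bar>s \<bullet> t\<bar> \<le> 1} \<longleftrightarrow>
      (\<forall>\<phi>. (\<forall>i. \<phi> i \<in> polar (coord_space (D i)) (Q i)) \<longrightarrow> \<bar>tensor \<phi> \<bullet> t\<bar> \<le> 1)"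
    using projective_tensor_le tensor_in_projective_tensor by (smt (verit) mem_Collect_eq subset_iff)
  then show ?thesis
    unfolding injective_tensor_def polar_def by blast
qed

text \<open>A member of \<open>GL_tensor D\<close> is constrained on \<open>tensor_space D\<close> only. Precomposing it with the projection
  onto that coordinate subspace makes it linear on all arrays.\<close>

lemma linear_extension_from_tensor_space:
  assumes "T \<in> GL_tensor D"
  obtains T' where "linear T'" "\<And>t. t \<in> tensor_space D \<Longrightarrow> T' t = T t"
proof
  let ?p = "coord_projection {m. \<forall>i. m i \<in> D i}"
  have add: "?p (s + t) = ?p s + ?p t" and scale: "?p (c *\<^sub>R t) = c *\<^sub>R ?p t" for s t c
    by (auto simp: coord_projection_def vec_eq_iff)
  have "?p t \<in> tensor_space D" for t by (auto simp: coord_projection_def tensor_space_def)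
  with assms show "linear (\<lambda>t. T (?p t))"
    unfolding GL_tensor_def by (intro linearI) (auto simp: add scale)
  show "T (?p t) = T t" if "t \<in> tensor_space D" for t
  proof -
    have "?p t = t" using that by (auto simp: coord_projection_def tensor_space_def vec_eq_iff)
    then show ?thesis by simp
  qed
qed

section \<open>Invariance of the tensorial bodies\<close>

theorem theorem3p12:
  fixes D :: "'l::finite \<Rightarrow> 'n::finite set"
    and T :: "real ^ ('l \<Rightarrow> 'n) \<Rightarrow> real ^ ('l \<Rightarrow> 'n)"
    and Q :: "(real ^ ('l \<Rightarrow> 'n)) set"
  assumes "\<And>i. card (D i) \<ge> 2"
    and "T \<in> GL_tensor D"
    and "Q \<in> tensorial_bodies D"
  shows "T ` Q \<in> tensorial_bodies D"
proof -
  obtain T' where T': "linear T'" and T'_eq: "\<And>t. t \<in> tensor_space D \<Longrightarrow> T' t = T t"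
    using linear_extension_from_tensor_space [OF assms(2)] by blast
  have "bij_betw T (tensor_space D) (tensor_space D)" using assms(2) unfolding GL_tensor_def by blast
  then have "bij_betw T' (tensor_space D) (tensor_space D)"
    using bij_betw_cong [of "tensor_space D" T' T] T'_eq by blast
  then have inj: "inj_on T' (tensor_space D)" and onto: "T' ` tensor_space D = tensor_space D"
    by (simp_all add: bij_betw_def)
  have dec: "decomposable D (T' t)" if t: "decomposable D t" for t
  proof -
    have "t \<in> tensor_space D" using t span_base [of t "Collect (decomposable D)"]
      by (simp add: span_decomposable)
    then show ?thesis using t assms(2) T'_eq unfolding GL_tensor_def by simp
  qed
  obtain \<tau> S where \<tau>: "bij \<tau>" and S: "\<And>i. linear (S i)" "\<And>i. inj_on (S i) (coord_space (D i))"
      "\<And>i. S i ` coord_space (D i) = coord_space (D (\<tau> i))"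
    and T'_tensor: "\<And>x. x \<in> Pi UNIV (\<lambda>i. coord_space (D i)) \<Longrightarrow>
       T' (tensor x) = tensor (\<lambda>j. S (inv \<tau> j) (x (inv \<tau> j)))"
    using decomposable_preserver_structure [OF assms(1) T' inj onto dec] by blast
  have inv\<tau> [simp]: "\<tau> (inv \<tau> j) = j" "inv \<tau> (\<tau> i) = i" for i j
    using \<tau> by (simp_all add: bij_is_surj surj_f_inv_f bij_is_inj)
  obtain P where Q: "symmetric_convex_body (tensor_space D) Q"
    and P: "\<And>i. symmetric_convex_body (coord_space (D i)) (P i)"
    and lower: "projective_tensor P \<subseteq> Q" and upper: "Q \<subseteq> injective_tensor D P"
    using assms(3) unfolding tensorial_bodies_def by blast
  have P_sub: "P i \<subseteq> coord_space (D i)" for i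
    using P unfolding symmetric_convex_body_def convex_body_def by blast
  have Q_sub: "Q \<subseteq> tensor_space D" and Q_convex: "convex Q"
    using Q unfolding symmetric_convex_body_def convex_body_def by blast+
  have img: "T ` Q = T' ` Q" using Q_sub T'_eq by (intro image_cong) auto
  define R where "R j = S (inv \<tau> j) ` P (inv \<tau> j)" for j
  have "symmetric_convex_body (coord_space (D j)) (R j)" for j
    unfolding R_def using S(3) [of "inv \<tau> j"]
    by (intro symmetric_convex_body_linear_image [OF S(1,2) _ subspace_coord_space P]) simp
  moreover have "projective_tensor R \<subseteq> T' ` Q"
  proof (rule projective_tensor_le)
    show "convex (T' ` Q)" by (rule convex_linear_image [OF T' Q_convex])
    fix x
    assume x: "\<And>j. x j \<in> R j"
    have "\<forall>i. \<exists>p. p \<in> P i \<and> x (\<tau> i) = S i p"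
    proof
      fix i
      show "\<exists>p. p \<in> P i \<and> x (\<tau> i) = S i p" using x [of "\<tau> i"] unfolding R_def by auto
    qed
    then obtain p where p: "\<And>i. p i \<in> P i" "\<And>i. x (\<tau> i) = S i (p i)" by metis
    have "x = (\<lambda>j. S (inv \<tau> j) (p (inv \<tau> j)))" using p(2) inv\<tau>(1) by metis
    moreover have "p \<in> Pi UNIV (\<lambda>i. coord_space (D i))" using p(1) P_sub by blast
    ultimately have "tensor x = T' (tensor p)" using T'_tensor [of p] by simp
    moreover have "tensor p \<in> Q" using lower tensor_in_projective_tensor [of p P] p(1) by blast
    ultimately show "tensor x \<in> T' ` Q" by blast
  qed
  moreover have "T' ` Q \<subseteq> injective_tensor D R"
  proof (rule image_subsetI)
    fix t
    assume t: "t \<in> Q"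
    have "\<bar>tensor \<phi> \<bullet> T' t\<bar> \<le> 1" if \<phi>: "\<forall>j. \<phi> j \<in> polar (coord_space (D j)) (R j)" for \<phi>
    proof -
      \<comment> \<open>The adjoint pulls \<open>\<phi>\<close> back; the projection moves it into the factor, where polars are taken,
        and does not change its pairing with vectors of that factor.\<close>
      define \<psi> where "\<psi> i = coord_projection (D i) (adjoint (S i) (\<phi> (\<tau> i)))" for i
      have adj: "x \<bullet> \<psi> i = S i x \<bullet> \<phi> (\<tau> i)" if "x \<in> coord_space (D i)" for x i
        using that unfolding \<psi>_def by (simp add: inner_coord_projection adjoint_works [OF S(1)])
      have "tensor \<psi> \<bullet> s = tensor \<phi> \<bullet> T' s" if "s \<in> tensor_space D" for s
      proof (rule tensor_space_induct [OF _ _ _ that])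
        show "linear (\<lambda>s. tensor \<psi> \<bullet> s)" "linear (\<lambda>s. tensor \<phi> \<bullet> T' s)"
          by (auto intro!: linearI simp: inner_add_right linear_add [OF T'] linear_scale [OF T'])
        fix x
        assume x: "x \<in> Pi UNIV (\<lambda>i. coord_space (D i))"
        have "tensor \<psi> \<bullet> tensor x = (\<Prod>i\<in>UNIV. \<phi> (\<tau> i) \<bullet> S i (x i))"
          unfolding inner_tensor
          by (rule prod.cong [OF refl]) (metis adj inner_commute Pi_mem UNIV_I x)
        also have "\<dots> = (\<Prod>j\<in>UNIV. \<phi> j \<bullet> S (inv \<tau> j) (x (inv \<tau> j)))"
          using prod.reindex_bij_betw [of \<tau> UNIV UNIV "\<lambda>j. \<phi> j \<bullet> S (inv \<tau> j) (x (inv \<tau> j))"] \<tau>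
          by simp
        also have "\<dots> = tensor \<phi> \<bullet> T' (tensor x)"
          using T'_tensor [OF x] by (simp add: inner_tensor)
        finally show "tensor \<psi> \<bullet> tensor x = tensor \<phi> \<bullet> T' (tensor x)" .
      qed
      moreover have "\<psi> i \<in> polar (coord_space (D i)) (P i)" for i
      proof -
        have "\<bar>x \<bullet> \<psi> i\<bar> \<le> 1" if "x \<in> P i" for x
        proof -
          have "S i x \<in> R (\<tau> i)" using that unfolding R_def by simp
          then have "\<bar>S i x \<bullet> \<phi> (\<tau> i)\<bar> \<le> 1" using \<phi> unfolding polar_def by blast
          moreover have "x \<in> coord_space (D i)" using that P_sub by blast
          ultimately show ?thesis by (simp only: adj)
        qed
        then show ?thesis
          unfolding polar_def using coord_projection_in [of "D i"] by (simp add: \<psi>_def)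
      qed
      ultimately show ?thesis using t upper injective_tensor_iff [of t D P] Q_sub by (metis subsetD)
    qed
    moreover have "T' t \<in> tensor_space D" using t Q_sub onto by blast
    ultimately show "T' t \<in> injective_tensor D R" by (simp add: injective_tensor_iff)
  qed
  moreover have "symmetric_convex_body (tensor_space D) (T' ` Q)"
    by (rule symmetric_convex_body_linear_image [OF T' inj onto subspace_tensor_space Q])
  ultimately show ?thesis unfolding img tensorial_bodies_def by blast
qed

end
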